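(* Let $A^+\subset\mathbb{R}^n$ be finite and $\beta\in\mathrm{conv}(A^+)\setminus A^+$. Let $f,g\in D_{A^+,\beta}$ with $f(x)=\sum_{\alpha\in A^+}c_\alpha e^{\langle x,\alpha\rangle}+c_\beta e^{\langle x,\beta\rangle}$ and $g(x)=\sum_{\alpha\in A^+}d_\alpha e^{\langle x,\alpha\rangle}+d_\beta e^{\langle x,\beta\rangle}$ such that $c_\beta,d_\beta<0$. Then $$h(x)\ =\ \sum_{\alpha\in A^+}c_\alpha d_\alpha e^{\langle x,\alpha\rangle}-c_\beta d_\beta e^{\langle x,\beta\rangle}\ \in\ D_{A^+,\beta}.$$
   Context: For $A^+\subset\mathbb{R}^n$ finite and $\beta\in\mathrm{conv}(A^+)\setminus A^+$ let $\Lambda(A^+,\beta)=\{\lambda\in\mathbb{R}_{\ge0}^{A^+}:\sum_{\alpha\in A^+}\lambda_\alpha\alpha=\beta,\ \sum_{\alpha\in A^+}\lambda_\alpha=1\}$. Signed DSONC cone: $D_{A^+,\beta}$ is the set of all exponential sums $\sum_{\alpha\in A^+}c_\alpha e^{\langle x,\alpha\rangle}+c_\beta e^{\langle x,\beta\rangle}$ ($x\in\mathbb{R}^n$) with $c_\alpha\ge0$ for all $\alpha\in A^+$ and such that either $c_\beta\ge0$, or $\ln|c_\beta|\le\sum_{\alpha\in A^+}\lambda_\alpha\ln(c_\alpha)$ for all $\lambda\in\Lambda(A^+,\beta)$ (conventions $\ln0=-\infty$ and $0\cdot(-\infty)=0$). The paper's standing assumption that all vertices of the convex hull of the support carry positive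 sign corresponds to $\beta\in\mathrm{conv}(A^+)$. *)

theory Defs
  imports "HOL-Analysis.Analysis"
begin

definition Lam :: "(real ^ 'n) set \<Rightarrow> real ^ 'n \<Rightarrow> (real ^ 'n \<Rightarrow> real) set" where
  "Lam A \<beta> = {l \<in> A \<rightarrow>\<^sub>E {0..}. (\<Sum>\<alpha>\<in>A. l \<alpha> *\<^sub>R \<alpha>) = \<beta> \<and> (\<Sum>\<alpha>\<in>A. l \<alpha>) = 1}"

text \<open>Logarithm with the convention that the value at zero is minus infinity (the library's
  real \<open>ln\<close> has \<open>ln 0 = 0\<close>); it is only meaningful for nonnegative arguments.
  The convention \<open>0 * (-\<infinity>) = 0\<close> is already the one of type \<^typ>\<open>ereal\<close>.\<close>

definition eln :: "real \<Rightarrow> ereal" where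
  "eln t = (if t = 0 then -\<infinity> else ereal (ln t))"

text \<open>The coefficient vector \<open>c\<close> is only read on \<open>insert \<beta> A\<close>; for \<open>\<beta> \<notin> A\<close> the value \<open>c \<beta>\<close>
  is independent of the coefficients on \<open>A\<close>.\<close>

definition exp_sum :: "(real ^ 'n) set \<Rightarrow> real ^ 'n \<Rightarrow> (real ^ 'n \<Rightarrow> real) \<Rightarrow> real ^ 'n \<Rightarrow> real" where
  "exp_sum A \<beta> c x = (\<Sum>\<alpha>\<in>A. c \<alpha> * exp (x \<bullet> \<alpha>)) + c \<beta> * exp (x \<bullet> \<beta>)"

definition dsonc_cone :: "(real ^ 'n) set \<Rightarrow> real ^ 'n \<Rightarrow> (real ^ 'n \<Rightarrow> real) set" where
  "dsonc_cone A \<beta> = {exp_sum A \<beta> c | c.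
     (\<forall>\<alpha>\<in>A. 0 \<le> c \<alpha>) \<and>
     (0 \<le> c \<beta> \<or>
      (\<forall>l\<in>Lam A \<beta>. eln \<bar>c \<beta>\<bar> \<le> (\<Sum>\<alpha>\<in>A. ereal (l \<alpha>) * eln (c \<alpha>))))}"

end

theory Submission
  imports Defs
begin

text \<open>Coefficients of an exponential sum are determined by the function, so both given
  representations satisfy the cone inequalities. Since \<open>ln\<close> turns products into sums,
  adding the inequalities for \<open>c\<close> and \<open>d\<close> yields the one for the coefficientwise product.\<close>

text \<open>The induction removes one exponent at a time. The coefficients \<open>a\<close> are
  generalized because eliminating \<open>\<gamma>\<close> rescales the ones that remain.\<close>

lemma exp_inner_independent:
  fixes S :: "'a::real_inner set" and a :: "'a \<Rightarrow> real"
  assumes "finite S" and "\<And>x. (\<Sum>\<alpha>\<in>S. a \<alpha> * exp (x \<bullet> \<alpha>)) = 0" and "\<alpha> \<in> S"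
  shows "a \<alpha> = 0"
  using assms
proof (induction S arbitrary: a \<alpha> rule: finite_induct)
  case empty
  then show ?case by simp
next
  case (insert \<gamma> S)
  have split: "a \<gamma> * exp (x \<bullet> \<gamma>) + (\<Sum>\<alpha>\<in>S. a \<alpha> * exp (x \<bullet> \<alpha>)) = 0" for x
    using insert.prems(1)[of x] insert.hyps by simp
  have S0: "a \<alpha> = 0" if "\<alpha> \<in> S" for \<alpha>
  proof -
    define y where "y = \<alpha> - \<gamma>"
    \<comment> \<open>\<open>F (x + y) - exp (y \<bullet> \<gamma>) * F x\<close> eliminates the \<open>\<gamma>\<close>-term of the sum \<open>F\<close>.\<close>
    have "(\<Sum>\<alpha>\<in>S. a \<alpha> * (exp (y \<bullet> \<alpha>) - exp (y \<bullet> \<gamma>)) * exp (x \<bullet> \<alpha>)) = 0" for x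
    proof -
      have "(\<Sum>\<alpha>\<in>S. a \<alpha> * (exp (y \<bullet> \<alpha>) - exp (y \<bullet> \<gamma>)) * exp (x \<bullet> \<alpha>))
          = (\<Sum>\<alpha>\<in>S. a \<alpha> * exp ((x + y) \<bullet> \<alpha>)) - exp (y \<bullet> \<gamma>) * (\<Sum>\<alpha>\<in>S. a \<alpha> * exp (x \<bullet> \<alpha>))"
        by (simp add: sum_distrib_left sum_subtractf[symmetric] inner_add_left exp_add
            algebra_simps)
      also have "\<dots> = - (a \<gamma> * exp ((x + y) \<bullet> \<gamma>)) + exp (y \<bullet> \<gamma>) * (a \<gamma> * exp (x \<bullet> \<gamma>))"
        using split[of "x + y"] split[of x] by (simp add: eq_neg_iff_add_eq_0[symmetric])
      also have "\<dots> = 0"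
        by (simp add: inner_add_left exp_add)
      finally show ?thesis .
    qed
    then have "a \<alpha> * (exp (y \<bullet> \<alpha>) - exp (y \<bullet> \<gamma>)) = 0"
      using insert.IH[of "\<lambda>\<alpha>. a \<alpha> * (exp (y \<bullet> \<alpha>) - exp (y \<bullet> \<gamma>))"] that by blast
    \<comment> \<open>With this choice of \<open>y\<close> the difference is the squared norm of
      \<open>\<alpha> - \<gamma>\<close>, which is positive since
      \<open>\<gamma> \<notin> S\<close>; hence the two exponentials differ.\<close>
    moreover have "y \<bullet> \<alpha> - y \<bullet> \<gamma> \<noteq> 0"
      using that insert.hyps unfolding inner_diff_right[symmetric] y_def by auto
    ultimately show ?thesis by simp
  qed
  then have "a \<gamma> = 0"
    using split[of 0] by simp
  with S0 insert.prems(2) show ?case by blast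
qed

lemma exp_sum_coeffs_unique:
  assumes "finite A" "\<beta> \<notin> A" "\<And>x. exp_sum A \<beta> c x = exp_sum A \<beta> d x" "\<alpha> \<in> insert \<beta> A"
  shows "c \<alpha> = d \<alpha>"
proof -
  have "(\<Sum>\<alpha>\<in>insert \<beta> A. (c \<alpha> - d \<alpha>) * exp (x \<bullet> \<alpha>)) = 0" for x
    using assms(1,2) assms(3)[of x] by (simp add: exp_sum_def sum_subtractf algebra_simps)
  then have "c \<alpha> - d \<alpha> = 0"
    using exp_inner_independent[of "insert \<beta> A" "\<lambda>\<alpha>. c \<alpha> - d \<alpha>"] assms(1,4) by blast
  then show ?thesis by simp
qed

text \<open>The cone only asserts that some representation satisfies the inequalities. Uniqueness of
  coefficients on \<open>insert \<beta> A\<close>, the only points read, transfers them to the given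
  \<open>c\<close>.\<close>

lemma exp_sum_in_dsonc_cone_iff:
  assumes "finite A" "\<beta> \<notin> A"
  shows "exp_sum A \<beta> c \<in> dsonc_cone A \<beta> \<longleftrightarrow> (\<forall>\<alpha>\<in>A. 0 \<le> c \<alpha>) \<and>
     (0 \<le> c \<beta> \<or> (\<forall>l\<in>Lam A \<beta>. eln \<bar>c \<beta>\<bar> \<le> (\<Sum>\<alpha>\<in>A. ereal (l \<alpha>) * eln (c \<alpha>))))"
    (is "_ \<longleftrightarrow> ?P c")
proof
  assume "exp_sum A \<beta> c \<in> dsonc_cone A \<beta>"
  then obtain c' where c': "exp_sum A \<beta> c = exp_sum A \<beta> c'" "?P c'"
    unfolding dsonc_cone_def by blast
  have "c \<alpha> = c' \<alpha>" if "\<alpha> \<in> insert \<beta> A" for \<alpha>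
    using exp_sum_coeffs_unique[OF assms _ that] c'(1) by metis
  with c'(2) show "?P c" by simp
qed (auto simp: dsonc_cone_def)

lemma eln_mult:
  assumes "0 \<le> s" "0 \<le> t"
  shows "eln (s * t) = eln s + eln t"
  using assms by (auto simp: eln_def ln_mult)

text \<open>Distributivity over \<open>ereal\<close> can fail when infinities of opposite sign meet.
  Since \<open>eln\<close> never takes the value +infinity, infinite terms here share one sign, and
  for \<open>r = 0\<close> both sides are 0.\<close>

lemma ereal_mult_eln_mult:
  assumes "0 \<le> s" "0 \<le> t"
  shows "ereal r * eln (s * t) = ereal r * eln s + ereal r * eln t"
  unfolding eln_mult[OF assms]
  by (cases r "0::real" rule: linorder_cases)
    (auto simp: eln_def algebra_simps)

theorem proposition4p18:
  fixes A :: "(real ^ 'n) set" and \<beta> :: "real ^ 'n"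
    and c d :: "real ^ 'n \<Rightarrow> real" and f g :: "real ^ 'n \<Rightarrow> real"
  assumes "finite A"
    and "\<beta> \<in> convex hull A - A"
    and "f \<in> dsonc_cone A \<beta>"
    and "g \<in> dsonc_cone A \<beta>"
    and "\<And>x. f x = (\<Sum>\<alpha>\<in>A. c \<alpha> * exp (x \<bullet> \<alpha>)) + c \<beta> * exp (x \<bullet> \<beta>)"
    and "\<And>x. g x = (\<Sum>\<alpha>\<in>A. d \<alpha> * exp (x \<bullet> \<alpha>)) + d \<beta> * exp (x \<bullet> \<beta>)"
    and "c \<beta> < 0"
    and "d \<beta> < 0"
  shows "(\<lambda>x. (\<Sum>\<alpha>\<in>A. c \<alpha> * d \<alpha> * exp (x \<bullet> \<alpha>)) - c \<beta> * d \<beta> * exp (x \<bullet> \<beta>)) \<in> dsonc_cone A \<beta>"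
proof -
  have \<beta>: "\<beta> \<notin> A" using assms(2) by blast
  have f: "f = exp_sum A \<beta> c" and g: "g = exp_sum A \<beta> d"
    using assms(5,6) by (auto simp: exp_sum_def)
  note iff = exp_sum_in_dsonc_cone_iff[OF assms(1) \<beta>]
  have c: "0 \<le> c \<alpha>" and d: "0 \<le> d \<alpha>" if "\<alpha> \<in> A" for \<alpha>
    using assms(3,4) that unfolding f g iff by auto
  \<comment> \<open>Negativity of \<open>c \<beta>\<close> and \<open>d \<beta>\<close> rules out
    the first alternative in the cone condition.\<close>
  have cl: "eln \<bar>c \<beta>\<bar> \<le> (\<Sum>\<alpha>\<in>A. ereal (l \<alpha>) * eln (c \<alpha>))"
    and dl: "eln \<bar>d \<beta>\<bar> \<le> (\<Sum>\<alpha>\<in>A. ereal (l \<alpha>) * eln (d \<alpha>))" if "l \<in> Lam A \<beta>" for l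
    using assms(3,4,7,8) that unfolding f g iff by auto
  \<comment> \<open>The sign flip at \<open>\<beta>\<close> keeps that coefficient negative, so the
    logarithmic alternative is the one to prove; there only the absolute value matters, and it is
    multiplicative.\<close>
  define h where "h = (\<lambda>\<alpha>. c \<alpha> * d \<alpha>)(\<beta> := - (c \<beta> * d \<beta>))"
  have h_A: "h \<alpha> = c \<alpha> * d \<alpha>" if "\<alpha> \<in> A" for \<alpha>
    using that \<beta> by (auto simp: h_def)
  have "eln \<bar>h \<beta>\<bar> \<le> (\<Sum>\<alpha>\<in>A. ereal (l \<alpha>) * eln (h \<alpha>))" if "l \<in> Lam A \<beta>" for l
  proof -
    have "eln \<bar>h \<beta>\<bar> = eln \<bar>c \<beta>\<bar> + eln \<bar>d \<beta>\<bar>"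
      by (simp add: h_def abs_mult eln_mult)
    also have "\<dots> \<le> (\<Sum>\<alpha>\<in>A. ereal (l \<alpha>) * eln (c \<alpha>)) + (\<Sum>\<alpha>\<in>A. ereal (l \<alpha>) * eln (d \<alpha>))"
      using cl[OF that] dl[OF that] by (rule add_mono)
    also have "\<dots> = (\<Sum>\<alpha>\<in>A. ereal (l \<alpha>) * eln (h \<alpha>))"
      by (simp add: sum.distrib[symmetric] h_A ereal_mult_eln_mult c d)
    finally show ?thesis .
  qed
  then have "exp_sum A \<beta> h \<in> dsonc_cone A \<beta>"
    unfolding iff using c d by (simp add: h_A)
  moreover have "exp_sum A \<beta> h =
      (\<lambda>x. (\<Sum>\<alpha>\<in>A. c \<alpha> * d \<alpha> * exp (x \<bullet> \<alpha>)) - c \<beta> * d \<beta> * exp (x \<bullet> \<beta>))"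
    by (rule ext) (simp add: exp_sum_def h_A, simp add: h_def)
  ultimately show ?thesis by simp
qed

end
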